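(* Let $0\to A\xrightarrow{i}V\xrightarrow{p}B\to 0$ be a short exact sequence in $\mathrm{DVect}$. The following are equivalent. (1) There exists a smooth linear map $r:V\to A$ such that $r\circ i=\mathrm{id}_A$. (2) There exists a smooth linear map $q:B\to V$ such that $p\circ q=\mathrm{id}_B$. (3) The short exact sequence is isomorphic in $\mathrm{DVect}$, with identity maps on $A$ and $B$, to $0\to A\xrightarrow{i_1}A\times B\xrightarrow{p_2}B\to 0$, where $i_1(a)=(a,0)$ and $p_2(a,b)=b$; that is, there is an isomorphism $\varphi:V\to A\times B$ in $\mathrm{DVect}$ with $\varphi\circ i=i_1$ and $p_2\circ\varphi=p$. (In particular, $V$ is then isomorphic to $A\times B$ in $\mathrm{DVect}$.)
   Context: A diffeological space is a set $X$ together with a specified set of functions $U\to X$ (called plots), for every open set $U\subseteq\mathbb{R}^n$ and every $n\in\mathbb{N}=\{0,1,2,\dots\}$, such that: (1) every constant map $U\to X$ is a plot; (2) if $U\to X$ is a plot and $V\to U$ is a smooth map between open subsets of Euclidean spaces, then $V\to U\to X$ is a plot; (3) if $U=\bigcup_i U_i$ is an open cover and $U\to X$ is a map whose restrictions to all $U_i$ are plots, then $U\to X$ is a plot. A map between diffeological spaces is smooth if composing with it sends plots to plots. Products carry the product diffeology (a map into a product is a plot iff all its components are plots), and $\mathbb{R}$ carries the standard diffeology. A diffeological vector space is a real vector space $V$ with a diffeology such that addition $V\times V\to V$ and scalar multiplication $\mathbb{R}\times V\to V$ are smooth. $\mathrm{DVect}$ is the category of diffeological vector spaces and smooth linear maps;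 an isomorphism in $\mathrm{DVect}$ is a smooth linear bijection with smooth inverse. A map $f:X\to Y$ of diffeological spaces is an induction if it is injective and a map $q:U\to X$ is a plot iff $f\circ q$ is a plot of $Y$. It is a subduction if it is smooth, surjective, and every plot of $Y$ locally (near each point of its domain) lifts along $f$ to a plot of $X$. A sequence $0\to A\xrightarrow{i}V\xrightarrow{p}B\to0$ of smooth linear maps of diffeological vector spaces is a short exact sequence in $\mathrm{DVect}$ if it is a short exact sequence of vector spaces, $i$ is an induction and $p$ is a subduction. *)

theory Defs
  imports "HOL-Analysis.Analysis"
begin

text \<open>
  \<open>\<real>\<^sup>n\<close> is the topological space \<^const>\<open>Euclidean_space\<close> \<open>n\<close>, whose points are the
  sequences \<open>x :: nat \<Rightarrow> real\<close> with \<open>x i = 0\<close> for all \<open>i \<ge> n\<close>. This makes the dimension a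
  value over which the axioms of a diffeology can quantify.
\<close>

definition partial_deriv :: "nat \<Rightarrow> ((nat \<Rightarrow> real) \<Rightarrow> real) \<Rightarrow> (nat \<Rightarrow> real) \<Rightarrow> real" where
  "partial_deriv i f x = deriv (\<lambda>t. f (x(i := t))) (x i)"

text \<open>
  \<open>Ck_on k m U f\<close>: the real-valued function \<open>f\<close> is of class \<open>C\<^sup>k\<close> on the open set \<open>U\<close> of
  \<open>\<real>\<^sup>m\<close>, i.e. all iterated partial derivatives of order at most \<open>k\<close> exist and are continuous
  on \<open>U\<close>.
\<close>

primrec Ck_on :: "nat \<Rightarrow> nat \<Rightarrow> (nat \<Rightarrow> real) set \<Rightarrow> ((nat \<Rightarrow> real) \<Rightarrow> real) \<Rightarrow> bool" where
  "Ck_on 0 m U f \<longleftrightarrow>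
     continuous_map (subtopology (Euclidean_space m) U) euclideanreal f"
| "Ck_on (Suc k) m U f \<longleftrightarrow>
     continuous_map (subtopology (Euclidean_space m) U) euclideanreal f \<and>
     (\<forall>i<m. (\<forall>x\<in>U. (\<lambda>t. f (x(i := t))) differentiable (at (x i))) \<and>
            Ck_on k m U (partial_deriv i f))"

definition smooth_fun_on :: "nat \<Rightarrow> (nat \<Rightarrow> real) set \<Rightarrow> ((nat \<Rightarrow> real) \<Rightarrow> real) \<Rightarrow> bool" where
  "smooth_fun_on m U f \<longleftrightarrow> (\<forall>k. Ck_on k m U f)"

definition smooth_map_between ::
  "nat \<Rightarrow> (nat \<Rightarrow> real) set \<Rightarrow> nat \<Rightarrow> (nat \<Rightarrow> real) set \<Rightarrow> ((nat \<Rightarrow> real) \<Rightarrow> (nat \<Rightarrow> real)) \<Rightarrow> bool"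
where
  "smooth_map_between m V n U h \<longleftrightarrow>
     h ` V \<subseteq> U \<and> (\<forall>j<n. smooth_fun_on m V (\<lambda>x. h x j))"

text \<open>
  A diffeology on the type \<open>'a\<close> is given by its plots: \<open>D n U f\<close> means that \<open>U\<close> is open in
  \<open>\<real>\<^sup>n\<close> and the restriction of \<open>f\<close> to \<open>U\<close> is a plot. Since HOL functions are total, axiom
  \<open>plot_cong\<close> says that only the values of \<open>f\<close> on \<open>U\<close> matter; restricting a plot
  then does not change the function.
\<close>

type_synonym 'a plots = "nat \<Rightarrow> (nat \<Rightarrow> real) set \<Rightarrow> ((nat \<Rightarrow> real) \<Rightarrow> 'a) \<Rightarrow> bool"

locale diffeology =
  fixes D :: "'a plots"
  assumes plot_open: "D n U f \<Longrightarrow> openin (Euclidean_space n) U"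
    and plot_cong: "D n U f \<Longrightarrow> (\<And>x. x \<in> U \<Longrightarrow> f x = g x) \<Longrightarrow> D n U g"
    and plot_const: "openin (Euclidean_space n) U \<Longrightarrow> D n U (\<lambda>_. c)"
    and plot_comp: "D n U f \<Longrightarrow> openin (Euclidean_space m) V \<Longrightarrow>
          smooth_map_between m V n U h \<Longrightarrow> D m V (f \<circ> h)"
    and plot_local: "(\<And>W. W \<in> \<W> \<Longrightarrow> openin (Euclidean_space n) W) \<Longrightarrow>
          (\<And>W. W \<in> \<W> \<Longrightarrow> D n W f) \<Longrightarrow> D n (\<Union>\<W>) f"

definition dsmooth :: "'a plots \<Rightarrow> 'b plots \<Rightarrow> ('a \<Rightarrow> 'b) \<Rightarrow> bool" where
  "dsmooth D E f \<longleftrightarrow> (\<forall>n U q. D n U q \<longrightarrow> E n U (f \<circ> q))"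

definition prod_diffeology :: "'a plots \<Rightarrow> 'b plots \<Rightarrow> ('a \<times> 'b) plots" where
  "prod_diffeology D E n U q \<longleftrightarrow> D n U (fst \<circ> q) \<and> E n U (snd \<circ> q)"

definition std_diffeology :: "real plots" where
  "std_diffeology n U q \<longleftrightarrow> openin (Euclidean_space n) U \<and> smooth_fun_on n U q"

definition diffeological_vector_space :: "'a::real_vector plots \<Rightarrow> bool" where
  "diffeological_vector_space D \<longleftrightarrow>
     diffeology D \<and>
     dsmooth (prod_diffeology D D) D (\<lambda>(x, y). x + y) \<and>
     dsmooth (prod_diffeology std_diffeology D) D (\<lambda>(c, x). c *\<^sub>R x)"

definition DVect_hom ::
  "'a::real_vector plots \<Rightarrow> 'b::real_vector plots \<Rightarrow> ('a \<Rightarrow> 'b) \<Rightarrow> bool" where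
  "DVect_hom D E f \<longleftrightarrow> linear f \<and> dsmooth D E f"

definition DVect_iso ::
  "'a::real_vector plots \<Rightarrow> 'b::real_vector plots \<Rightarrow> ('a \<Rightarrow> 'b) \<Rightarrow> bool" where
  "DVect_iso D E f \<longleftrightarrow> DVect_hom D E f \<and> bij f \<and> dsmooth E D (inv f)"

definition induction_map :: "'a plots \<Rightarrow> 'b plots \<Rightarrow> ('a \<Rightarrow> 'b) \<Rightarrow> bool" where
  "induction_map D E f \<longleftrightarrow> inj f \<and> (\<forall>n U q. D n U q \<longleftrightarrow> E n U (f \<circ> q))"

definition subduction_map :: "'a plots \<Rightarrow> 'b plots \<Rightarrow> ('a \<Rightarrow> 'b) \<Rightarrow> bool" where
  "subduction_map D E f \<longleftrightarrow>
     dsmooth D E f \<and> surj f \<and>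
     (\<forall>n U q. E n U q \<longrightarrow>
        (\<forall>x\<in>U. \<exists>W s. openin (Euclidean_space n) W \<and> x \<in> W \<and> W \<subseteq> U \<and>
                     D n W s \<and> (\<forall>y\<in>W. f (s y) = q y)))"

definition DVect_short_exact ::
  "'a::real_vector plots \<Rightarrow> 'v::real_vector plots \<Rightarrow> 'b::real_vector plots \<Rightarrow>
   ('a \<Rightarrow> 'v) \<Rightarrow> ('v \<Rightarrow> 'b) \<Rightarrow> bool" where
  "DVect_short_exact DA DV DB i p \<longleftrightarrow>
     DVect_hom DA DV i \<and> DVect_hom DV DB p \<and>
     inj i \<and> range i = {v. p v = 0} \<and> surj p \<and>
     induction_map DA DV i \<and> subduction_map DV DB p"

end

theory Submission
  imports Defs
begin

text \<open>
  A retraction \<open>r\<close> gives \<open>\<phi> = (r, p)\<close>; it is a linear bijection, and if a plot \<open>s\<close> of \<open>V\<close> is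
  a local lift of the second component of a plot \<open>(a, b)\<close> of \<open>A \<times> B\<close>, then
  \<open>\<phi>\<^sup>-\<^sup>1 \<circ> (a, b) = s + i (a - r s)\<close> locally, so \<open>\<phi>\<^sup>-\<^sup>1\<close> is smooth because \<open>p\<close> is a subduction.
  An isomorphism \<open>\<phi>\<close> gives the section \<open>b \<mapsto> \<phi>\<^sup>-\<^sup>1 (0, b)\<close>. Finally, for a section \<open>q\<close> the map
  \<open>v \<mapsto> v - q (p v)\<close> takes values in the range of \<open>i\<close>, hence factors through a retraction, which is
  smooth because \<open>i\<close> is an induction.
\<close>

section \<open>Smoothness of constant and coordinate functions\<close>

lemma partial_deriv_const: "partial_deriv i (\<lambda>_. c) = (\<lambda>_. 0)"
  by (simp add: partial_deriv_def fun_eq_iff)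

lemma Ck_on_const: "Ck_on k m U (\<lambda>_. c)"
  by (induction k arbitrary: c) (simp_all add: partial_deriv_const)

lemma smooth_fun_on_const: "smooth_fun_on m U (\<lambda>_. c)"
  by (simp add: smooth_fun_on_def Ck_on_const)

lemma partial_deriv_coordinate:
  "partial_deriv i (\<lambda>x. x j) = (\<lambda>_. if i = j then 1 else 0)"
  by (auto simp: partial_deriv_def fun_eq_iff)

lemma continuous_map_Euclidean_coordinate:
  "continuous_map (subtopology (Euclidean_space m) U) euclideanreal (\<lambda>x. x j)"
  unfolding Euclidean_space_def
  by (intro continuous_map_from_subtopology continuous_map_product_projection) simp

text \<open>Every partial derivative of a coordinate is the constant 0 or 1, so all higher orders
  reduce to the constant case. This is what makes inclusions of open sets smooth.\<close>

lemma smooth_fun_on_coordinate: "smooth_fun_on m U (\<lambda>x. x j)"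
  unfolding smooth_fun_on_def
proof
  fix k
  have "(\<lambda>t. (x(i := t)) j) differentiable (at (x i))" for x :: "nat \<Rightarrow> real" and i
    by (cases "i = j") simp_all
  then show "Ck_on k m U (\<lambda>x. x j)"
    by (cases k)
      (simp_all add: continuous_map_Euclidean_coordinate partial_deriv_coordinate Ck_on_const
        del: fun_upd_apply)
qed

section \<open>Locality of plots\<close>

context diffeology
begin

text \<open>Restriction is composition with the inclusion of \<open>W\<close> in \<open>U\<close>,
  whose components are coordinates.\<close>

lemma plot_restrict:
  assumes "D n U f" "openin (Euclidean_space n) W" "W \<subseteq> U"
  shows "D n W f"
proof -
  have "smooth_map_between n W n U (\<lambda>x. x)"
    using assms(3) by (auto simp: smooth_map_between_def smooth_fun_on_coordinate)
  from plot_comp[OF assms(1,2) this] show ?thesis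
    by (simp add: comp_def)
qed

lemma plot_locally:
  assumes "\<And>x. x \<in> U \<Longrightarrow> \<exists>W. openin (Euclidean_space n) W \<and> x \<in> W \<and> W \<subseteq> U \<and> D n W f"
  shows "D n U f"
proof -
  \<comment> \<open>No choice of neighbourhoods is needed: the cover consists of all open subsets on
    which \<open>f\<close> is a plot.\<close>
  let ?\<W> = "{W. openin (Euclidean_space n) W \<and> W \<subseteq> U \<and> D n W f}"
  have "D n (\<Union>?\<W>) f"
    by (rule plot_local) auto
  moreover have "\<Union>?\<W> = U"
    using assms by blast
  ultimately show ?thesis
    by simp
qed

end

section \<open>Smooth maps and pointwise operations on plots\<close>

lemma dsmoothD: "dsmooth D E f \<Longrightarrow> D n U q \<Longrightarrow> E n U (\<lambda>x. f (q x))"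
  by (auto simp: dsmooth_def comp_def)

lemma dsmooth_comp: "dsmooth D E f \<Longrightarrow> dsmooth E F g \<Longrightarrow> dsmooth D F (g \<circ> f)"
  by (auto simp: dsmooth_def comp_assoc)

lemma dsmooth_id: "dsmooth D D (\<lambda>x. x)"
  by (simp add: dsmooth_def comp_def)

lemma dsmooth_const:
  assumes "diffeology D" "diffeology E"
  shows "dsmooth D E (\<lambda>_. c)"
  using diffeology.plot_const[OF assms(2) diffeology.plot_open[OF assms(1)]]
  by (auto simp: dsmooth_def comp_def)

lemma dsmooth_Pair:
  "dsmooth D E f \<Longrightarrow> dsmooth D F g \<Longrightarrow> dsmooth D (prod_diffeology E F) (\<lambda>x. (f x, g x))"
  by (simp add: dsmooth_def prod_diffeology_def comp_def)

lemma diffeological_vector_space_plot_add: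
  assumes "diffeological_vector_space D" "D n U f" "D n U g"
  shows "D n U (\<lambda>x. f x + g x)"
  using dsmoothD[of "prod_diffeology D D" D "\<lambda>(x, y). x + y" n U "\<lambda>x. (f x, g x)"] assms
  by (simp add: diffeological_vector_space_def prod_diffeology_def comp_def)

text \<open>The fixed scalar \<open>c\<close> enters as a constant plot of the real line.\<close>

lemma diffeological_vector_space_plot_scaleR:
  assumes "diffeological_vector_space D" "D n U f"
  shows "D n U (\<lambda>x. c *\<^sub>R f x)"
proof -
  have "openin (Euclidean_space n) U"
    using assms diffeology.plot_open by (auto simp: diffeological_vector_space_def)
  then show ?thesis
    using dsmoothD[of "prod_diffeology std_diffeology D" D "\<lambda>(c, x). c *\<^sub>R x" n U "\<lambda>x. (c, f x)"]
      assms
    by (simp add: diffeological_vector_space_def prod_diffeology_def std_diffeology_def comp_def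
        smooth_fun_on_const)
qed

lemma diffeological_vector_space_plot_diff:
  assumes "diffeological_vector_space D" "D n U f" "D n U g"
  shows "D n U (\<lambda>x. f x - g x)"
  using diffeological_vector_space_plot_add[OF assms(1), OF assms(2)
      diffeological_vector_space_plot_scaleR[OF assms(1), OF assms(3), of "-1"]]
  by simp

section \<open>Splittings of a short exact sequence\<close>

locale DVect_exact_sequence =
  fixes DA :: "'a::real_vector plots"
    and DV :: "'v::real_vector plots"
    and DB :: "'b::real_vector plots"
    and i :: "'a \<Rightarrow> 'v" and p :: "'v \<Rightarrow> 'b"
  assumes A: "diffeological_vector_space DA"
    and V: "diffeological_vector_space DV"
    and B: "diffeological_vector_space DB"
    and exact: "DVect_short_exact DA DV DB i p"
begin

lemma linear_i: "linear i" and smooth_i: "dsmooth DA DV i"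
  and linear_p: "linear p" and smooth_p: "dsmooth DV DB p"
  and inj_i: "inj i"
  and range_i: "range i = {v. p v = 0}"
  and plot_i_iff: "DA n U f \<longleftrightarrow> DV n U (\<lambda>x. i (f x))"
  using exact
  by (auto simp: DVect_short_exact_def DVect_hom_def induction_map_def comp_def)

lemma p_i: "p (i a) = 0"
  using range_i by auto

lemma p_lift:
  assumes "DB n U f" "x \<in> U"
  obtains W s where "openin (Euclidean_space n) W" "x \<in> W" "W \<subseteq> U" "DV n W s"
    "\<And>y. y \<in> W \<Longrightarrow> p (s y) = f y"
  using exact assms unfolding DVect_short_exact_def subduction_map_def by metis

text \<open>The inverse is described at points \<open>(a, p v)\<close>, which are all points since
  \<open>p\<close> is surjective. Here \<open>v\<close> may be any lift of the second component:
  adding \<open>i (a - r v)\<close> corrects its first component to \<open>a\<close> and leaves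
  \<open>p v\<close> unchanged.\<close>

lemma inv_retraction_pair:
  assumes "linear r" "r \<circ> i = id"
  shows "bij (\<lambda>v. (r v, p v))"
    and "inv (\<lambda>v. (r v, p v)) (a, p v) = v + i (a - r v)"
proof -
  let ?\<phi> = "\<lambda>v. (r v, p v)"
  have r_i: "r (i a) = a" for a
    using assms(2) by (simp add: fun_eq_iff)
  have "linear ?\<phi>"
    using assms(1) linear_p by (simp add: linear_iff)
  \<comment> \<open>The second component puts \<open>v\<close> in the range of \<open>i\<close>; the
    first then kills its preimage, as \<open>r\<close> inverts \<open>i\<close> there.\<close>
  moreover have "v = 0" if "?\<phi> v = 0" for v
  proof -
    from that range_i obtain a where "v = i a"
      by (auto simp: zero_prod_def)
    with that show ?thesis
      using r_i linear_0[OF linear_i] by (simp add: zero_prod_def)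
  qed
  ultimately have inj: "inj ?\<phi>"
    by (simp add: linear_injective_0)
  have preimage: "?\<phi> (v + i (a - r v)) = (a, p v)" for a v
    by (simp add: linear_add[OF assms(1)] linear_add[OF linear_p] r_i p_i)
  show "inv ?\<phi> (a, p v) = v + i (a - r v)"
    using inv_f_f[OF inj] preimage by metis
  have "surj p"
    using exact by (simp add: DVect_short_exact_def)
  then have "surj ?\<phi>"
    unfolding surj_def by (metis preimage surj_pair)
  with inj show "bij ?\<phi>"
    by (simp add: bij_def)
qed

lemma retraction_imp_product:
  assumes r: "DVect_hom DV DA r" "r \<circ> i = id"
  shows "DVect_iso DV (prod_diffeology DA DB) (\<lambda>v. (r v, p v))"
proof -
  let ?\<phi> = "\<lambda>v. (r v, p v)"
  have lin: "linear r" and sm: "dsmooth DV DA r"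
    using r(1) by (auto simp: DVect_hom_def)
  interpret A: diffeology DA
    using A by (simp add: diffeological_vector_space_def)
  interpret V: diffeology DV
    using V by (simp add: diffeological_vector_space_def)
  have "DV n U (inv ?\<phi> \<circ> f)" if "prod_diffeology DA DB n U f" for n U f
  proof (rule V.plot_locally)
    from that have fA: "DA n U (\<lambda>x. fst (f x))" and fB: "DB n U (\<lambda>x. snd (f x))"
      by (simp_all add: prod_diffeology_def comp_def)
    fix x assume "x \<in> U"
    with fB obtain W s where W: "openin (Euclidean_space n) W" "x \<in> W" "W \<subseteq> U"
      and s: "DV n W s" "\<And>y. y \<in> W \<Longrightarrow> p (s y) = snd (f y)"
      by (rule p_lift) blast
    have "DA n W (\<lambda>y. fst (f y) - r (s y))"
      using A.plot_restrict[OF fA W(1,3)] dsmoothD[OF sm, OF s(1)]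
      by (rule diffeological_vector_space_plot_diff[OF A])
    then have "DV n W (\<lambda>y. s y + i (fst (f y) - r (s y)))"
      using diffeological_vector_space_plot_add[OF V, OF s(1)] by (simp only: plot_i_iff)
    moreover have "s y + i (fst (f y) - r (s y)) = (inv ?\<phi> \<circ> f) y" if "y \<in> W" for y
      using inv_retraction_pair(2)[OF lin r(2), of "fst (f y)" "s y"] s(2)[OF that] by simp
    \<comment> \<open>The lift \<open>s\<close> is controlled only on \<open>W\<close>, so the two
      functions are known to agree only there.\<close>
    ultimately have "DV n W (inv ?\<phi> \<circ> f)"
      by (rule V.plot_cong)
    with W show "\<exists>W. openin (Euclidean_space n) W \<and> x \<in> W \<and> W \<subseteq> U \<and> DV n W (inv ?\<phi> \<circ> f)"
      by blast
  qed
  then have "dsmooth (prod_diffeology DA DB) DV (inv ?\<phi>)"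
    by (simp add: dsmooth_def)
  moreover have "linear ?\<phi>"
    using lin linear_p by (simp add: linear_iff)
  ultimately show ?thesis
    using inv_retraction_pair(1)[OF lin r(2)] dsmooth_Pair[OF sm smooth_p]
    by (simp add: DVect_iso_def DVect_hom_def)
qed

lemma product_imp_section:
  assumes "DVect_iso DV (prod_diffeology DA DB) \<phi>" "snd \<circ> \<phi> = p"
  shows "DVect_hom DB DV (\<lambda>b. inv \<phi> (0, b))" "p \<circ> (\<lambda>b. inv \<phi> (0, b)) = id"
proof -
  have lin: "linear \<phi>" and bij: "bij \<phi>"
    and sm: "dsmooth (prod_diffeology DA DB) DV (inv \<phi>)"
    using assms(1) by (auto simp: DVect_iso_def DVect_hom_def)
  \<comment> \<open>Both linearity identities are checked after applying the injective map
    \<open>\<phi>\<close>.\<close>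
  have "linear (inv \<phi>)"
    using lin bij
    by (auto intro!: linearI injD[OF bij_is_inj[OF bij]]
        simp: linear_add linear_scale surj_f_inv_f bij_is_surj)
  moreover have "linear (\<lambda>b. (0::'a, b::'b))"
    by (simp add: linear_iff)
  ultimately have "linear (inv \<phi> \<circ> (\<lambda>b. (0, b)))"
    by (metis linear_compose)
  moreover have "dsmooth DB (prod_diffeology DA DB) (\<lambda>b. (0, b))"
    using A B
    by (intro dsmooth_Pair dsmooth_const dsmooth_id) (simp_all add: diffeological_vector_space_def)
  then have "dsmooth DB DV (inv \<phi> \<circ> (\<lambda>b. (0, b)))"
    using sm by (rule dsmooth_comp)
  ultimately show "DVect_hom DB DV (\<lambda>b. inv \<phi> (0, b))"
    by (simp add: DVect_hom_def comp_def)
  show "p \<circ> (\<lambda>b. inv \<phi> (0, b)) = id"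
    using bij by (simp flip: assms(2) add: fun_eq_iff surj_f_inv_f bij_is_surj)
qed

lemma section_imp_retraction:
  assumes q: "DVect_hom DB DV q" "p \<circ> q = id"
  obtains r where "DVect_hom DV DA r" "r \<circ> i = id"
proof
  have lin: "linear q" and sm: "dsmooth DB DV q"
    using q(1) by (auto simp: DVect_hom_def)
  \<comment> \<open>\<open>inv i\<close> is meaningful only on the range of \<open>i\<close>; the
    argument lies there because \<open>p\<close> kills it, by exactness.\<close>
  define r where "r v = inv i (v - q (p v))" for v
  have "p (v - q (p v)) = 0" for v
    using q(2) by (simp add: linear_diff[OF linear_p] fun_eq_iff)
  then have i_r: "i (r v) = v - q (p v)" for v
    unfolding r_def using range_i by (intro f_inv_into_f) blast
  have "linear r"
  proof (rule linearI)
    show "r (x + y) = r x + r y" for x y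
      by (rule injD[OF inj_i])
        (simp add: i_r linear_add[OF linear_i] linear_add[OF linear_p] linear_add[OF lin])
    show "r (c *\<^sub>R x) = c *\<^sub>R r x" for c x
      by (rule injD[OF inj_i])
        (simp add: i_r linear_scale[OF linear_i] linear_scale[OF linear_p] linear_scale[OF lin]
          scaleR_diff_right)
  qed
  \<comment> \<open>As \<open>i\<close> is an induction, it suffices that \<open>i\<close> composed
    with \<open>r\<close> and \<open>f\<close> is a plot, and this is a difference of plots of
    \<open>DV\<close>.\<close>
  moreover have "DA n U (\<lambda>x. r (f x))" if "DV n U f" for n U f
    using diffeological_vector_space_plot_diff[OF V, OF that
        dsmoothD[OF sm, OF dsmoothD[OF smooth_p, OF that]]]
    by (simp add: plot_i_iff i_r)
  ultimately show "DVect_hom DV DA r"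
    by (simp add: DVect_hom_def dsmooth_def comp_def)
  show "r \<circ> i = id"
    by (simp add: fun_eq_iff r_def p_i linear_0[OF lin] inv_f_f[OF inj_i])
qed

end

theorem theorem3p16:
  fixes DA :: "'a::real_vector plots"
    and DV :: "'v::real_vector plots"
    and DB :: "'b::real_vector plots"
    and i :: "'a \<Rightarrow> 'v" and p :: "'v \<Rightarrow> 'b"
  assumes "diffeological_vector_space DA"
    and "diffeological_vector_space DV"
    and "diffeological_vector_space DB"
    and "DVect_short_exact DA DV DB i p"
  shows
    "((\<exists>r. DVect_hom DV DA r \<and> r \<circ> i = id) \<longleftrightarrow>
      (\<exists>q. DVect_hom DB DV q \<and> p \<circ> q = id)) \<and>
     ((\<exists>q. DVect_hom DB DV q \<and> p \<circ> q = id) \<longleftrightarrow>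
      (\<exists>\<phi>. DVect_iso DV (prod_diffeology DA DB) \<phi> \<and>
            \<phi> \<circ> i = (\<lambda>a. (a, 0)) \<and> snd \<circ> \<phi> = p))"
    (is "(?retraction \<longleftrightarrow> ?section) \<and> (?section \<longleftrightarrow> ?product)")
proof -
  interpret DVect_exact_sequence DA DV DB i p
    using assms by unfold_locales
  have "?product" if "?retraction"
  proof -
    from that obtain r where r: "DVect_hom DV DA r" "r \<circ> i = id"
      by blast
    then have "(\<lambda>v. (r v, p v)) \<circ> i = (\<lambda>a. (a, 0))" "snd \<circ> (\<lambda>v. (r v, p v)) = p"
      by (simp_all add: fun_eq_iff p_i)
    with retraction_imp_product[OF r] show ?thesis
      by blast
  qed
  moreover have "?section" if "?product"
    using that product_imp_section by blast
  moreover have "?retraction" if "?section"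
    using that section_imp_retraction by metis
  \<comment> \<open>The implications form a cycle: retraction, product, section, retraction.\<close>
  ultimately show ?thesis
    by blast
qed

end
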